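(* For every real-valued function $f \in L^1(\mathbb{R}) \cap L^2(\mathbb{R})$, $$ \int_{-\frac{1}{2}}^{\frac{1}{2}} \int_{\mathbb{R}} f(x) f(x+t)\, dx\, dt \leq 0.91\, \|f\|_{L^1}\|f\|_{L^2}.$$ Moreover, the constant $0.91$ cannot be replaced by $0.8$; that is, there exists a real-valued $f \in L^1(\mathbb{R}) \cap L^2(\mathbb{R})$ such that $$ \int_{-\frac{1}{2}}^{\frac{1}{2}} \int_{\mathbb{R}} f(x) f(x+t)\, dx\, dt > 0.8\, \|f\|_{L^1}\|f\|_{L^2}.$$
   Context: All functions are real-valued and Lebesgue measurable on $\mathbb{R}$. The norms are $\|f\|_{L^1} = \int_{\mathbb{R}} |f(x)|\,dx$ and $\|f\|_{L^2} = \left(\int_{\mathbb{R}} |f(x)|^2\,dx\right)^{1/2}$. *)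

theory Defs
  imports "HOL-Analysis.Analysis"
begin

definition L1_fun :: "(real \<Rightarrow> real) \<Rightarrow> bool" where
  "L1_fun f \<longleftrightarrow> f \<in> borel_measurable lebesgue \<and> integrable lebesgue (\<lambda>x. \<bar>f x\<bar>)"

definition L2_fun :: "(real \<Rightarrow> real) \<Rightarrow> bool" where
  "L2_fun f \<longleftrightarrow> f \<in> borel_measurable lebesgue \<and> integrable lebesgue (\<lambda>x. \<bar>f x\<bar> ^ 2)"

definition L1_norm :: "(real \<Rightarrow> real) \<Rightarrow> real" where
  "L1_norm f = (LINT x|lebesgue. \<bar>f x\<bar>)"

definition L2_norm :: "(real \<Rightarrow> real) \<Rightarrow> real" where
  "L2_norm f = sqrt (LINT x|lebesgue. \<bar>f x\<bar> ^ 2)"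

end

theory Submission
  imports Defs
begin

text \<open>Replacing $f$ by $g = |f|$ only increases the left-hand side, so let $g \ge 0$ and let
$S = \int\!\!\int w(x-y)\, g(x)\, g(y)\,dx\,dy$ with $w$ the indicator function of $[-1/2,1/2]$. Write
$q$ and $p$ for the $L^1$ and $L^2$ norms of $g$. Since $w \le 1$ and $\int w = 1$, trivially
$S \le q^2$ and $S \le p^2$. These give $S \le 0.91\,pq$ unless $p$ and $q$ are nearly equal, and in that
range a third bound is used that mixes both norms.

For the third bound take any kernel $k \ge 0$ and a constant $c \ge 0$, and integrate
$2 \cdot c g \cdot (k * g) \le c^2 g^2 + (k * g)^2$. Both terms that contain $k$ are again quadratic forms
$\int\!\!\int v(x-y)\,g(x)\,g(y)$, the first with $v = 2ck$ and the second with $v$ equal to the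
autocorrelation $A_k$ of $k$. Hence, as soon as $w + A_k \le b + 2ck$ holds pointwise, the form with weight
$A_k$ cancels and $S \le b q^2 + c^2 p^2$ remains (lemma \<open>pair_energy_le_of_kernel\<close>). For even
$k$ the square says in Fourier terms that $c^2\delta - 2ck + A_k$ has the transform $(c - \hat k)^2 \ge 0$; the
explicit square takes the place of Plancherel's theorem. Because $g \ge 0$, an upper bound on
$w + A_k - 2ck$ is enough.

The kernel $k(t) = 1 - |t|/2$ on $[-1/2,1/2]$ admits $b = 2/5$ and $c = 7/10$
(lemma \<open>roof_kernel_bound\<close>). These values are convenient because
$91 pq - 40 q^2 - 49 p^2 = (7p - 5q)(8q - 7p)$, which is nonnegative exactly in a range of $p/q$ outside which
one of the trivial bounds suffices (lemma \<open>le_of_quadratic_bounds\<close>).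

For the lower bound $0.8$ the function $x(1-x)$ on $[0,1]$ is a witness: its quotient is
$\frac{47}{1920} \cdot 6 \cdot \sqrt{30} \approx 0.8045$.\<close>

section \<open>Quadratic forms with a translation-invariant weight\<close>

definition pair_energy :: "(real \<Rightarrow> ennreal) \<Rightarrow> (real \<Rightarrow> ennreal) \<Rightarrow> ennreal" where
  "pair_energy w g = (\<integral>\<^sup>+x. \<integral>\<^sup>+y. w (x - y) * (g x * g y) \<partial>lborel \<partial>lborel)"

definition autocorr :: "(real \<Rightarrow> ennreal) \<Rightarrow> real \<Rightarrow> ennreal" where
  "autocorr g t = (\<integral>\<^sup>+x. g x * g (x + t) \<partial>lborel)"

definition smear :: "(real \<Rightarrow> ennreal) \<Rightarrow> (real \<Rightarrow> ennreal) \<Rightarrow> real \<Rightarrow> ennreal" where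
  "smear k g x = (\<integral>\<^sup>+y. k (x - y) * g y \<partial>lborel)"

lemma nn_integral_shift:
  fixes f :: "real \<Rightarrow> ennreal"
  assumes "f \<in> borel_measurable borel"
  shows "(\<integral>\<^sup>+x. f x \<partial>lborel) = (\<integral>\<^sup>+x. f (t + x) \<partial>lborel)"
  using nn_integral_real_affine[OF assms, of 1 t] by simp

lemma autocorr_measurable [measurable]:
  assumes [measurable]: "g \<in> borel_measurable borel"
  shows "autocorr g \<in> borel_measurable borel"
  unfolding autocorr_def by measurable

lemma smear_measurable [measurable]:
  assumes [measurable]: "k \<in> borel_measurable borel" "g \<in> borel_measurable borel"
  shows "smear k g \<in> borel_measurable borel"
  unfolding smear_def by measurable

lemma pair_energy_mono:
  "(\<And>t. v t \<le> w t) \<Longrightarrow> pair_energy v g \<le> pair_energy w g"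
  unfolding pair_energy_def by (intro nn_integral_mono mult_right_mono) auto

lemma pair_energy_add:
  assumes [measurable]: "v \<in> borel_measurable borel" "w \<in> borel_measurable borel"
    "g \<in> borel_measurable borel"
  shows "pair_energy (\<lambda>t. v t + w t) g = pair_energy v g + pair_energy w g"
  unfolding pair_energy_def
  by (simp add: distrib_right nn_integral_add)

lemma pair_energy_cmult:
  assumes [measurable]: "w \<in> borel_measurable borel" "g \<in> borel_measurable borel"
  shows "pair_energy (\<lambda>t. c * w t) g = c * pair_energy w g"
  unfolding pair_energy_def
  by (simp add: mult.assoc nn_integral_cmult)

lemma pair_energy_const:
  assumes [measurable]: "g \<in> borel_measurable borel"
  shows "pair_energy (\<lambda>t. c) g = c * (\<integral>\<^sup>+x. g x \<partial>lborel)\<^sup>2"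
  unfolding pair_energy_def
  by (simp add: nn_integral_cmult nn_integral_multc power2_eq_square)

lemma pair_energy_eq_smear:
  assumes [measurable]: "w \<in> borel_measurable borel" "g \<in> borel_measurable borel"
  shows "pair_energy w g = (\<integral>\<^sup>+x. g x * smear w g x \<partial>lborel)"
  unfolding pair_energy_def smear_def
  by (simp add: nn_integral_cmult[symmetric] mult_ac)

text \<open>Grouping the pairs $(x,y)$ by their difference turns the quadratic form into the weighted integral of the
autocorrelation that occurs in the main inequality.\<close>

lemma pair_energy_eq_autocorr:
  assumes [measurable]: "w \<in> borel_measurable borel" "g \<in> borel_measurable borel"
  shows "pair_energy w g = (\<integral>\<^sup>+t. w t * autocorr g t \<partial>lborel)"
proof -
  have "pair_energy w g = (\<integral>\<^sup>+y. \<integral>\<^sup>+x. w (x - y) * (g x * g y) \<partial>lborel \<partial>lborel)"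
    unfolding pair_energy_def by (rule lborel_pair.Fubini') measurable
  also have "\<dots> = (\<integral>\<^sup>+y. \<integral>\<^sup>+t. w t * (g y * g (y + t)) \<partial>lborel \<partial>lborel)"
  proof (rule nn_integral_cong)
    fix y :: real
    show "(\<integral>\<^sup>+x. w (x - y) * (g x * g y) \<partial>lborel) = (\<integral>\<^sup>+t. w t * (g y * g (y + t)) \<partial>lborel)"
      by (subst nn_integral_shift[where t = y]) (simp_all add: mult_ac)
  qed
  also have "\<dots> = (\<integral>\<^sup>+t. \<integral>\<^sup>+y. w t * (g y * g (y + t)) \<partial>lborel \<partial>lborel)"
    by (rule lborel_pair.Fubini') measurable
  also have "\<dots> = (\<integral>\<^sup>+t. w t * autocorr g t \<partial>lborel)"
    unfolding autocorr_def by (simp add: nn_integral_cmult)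
  finally show ?thesis .
qed

text \<open>Expanding the square of $\int k(x-y)\,g(y)\,dy$ and integrating over $x$ first leaves
$\int k(x-y)\,k(x-z)\,dx$, which by translation depends only on $y-z$. So the square of the smeared function
is of the same type as the forms it is to be compared with.\<close>

lemma nn_integral_smear_sq:
  assumes [measurable]: "k \<in> borel_measurable borel" "g \<in> borel_measurable borel"
  shows "(\<integral>\<^sup>+x. (smear k g x)\<^sup>2 \<partial>lborel) = pair_energy (autocorr k) g"
proof -
  have "(\<integral>\<^sup>+x. (smear k g x)\<^sup>2 \<partial>lborel)
      = (\<integral>\<^sup>+x. \<integral>\<^sup>+y. \<integral>\<^sup>+z. (k (x - y) * g y) * (k (x - z) * g z) \<partial>lborel \<partial>lborel \<partial>lborel)"
    unfolding smear_def power2_eq_square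
    by (simp add: nn_integral_cmult nn_integral_multc)
  also have "\<dots> = (\<integral>\<^sup>+y. \<integral>\<^sup>+x. \<integral>\<^sup>+z. (k (x - y) * g y) * (k (x - z) * g z) \<partial>lborel \<partial>lborel \<partial>lborel)"
    by (rule lborel_pair.Fubini') measurable
  also have "\<dots> = (\<integral>\<^sup>+y. \<integral>\<^sup>+z. \<integral>\<^sup>+x. (k (x - y) * g y) * (k (x - z) * g z) \<partial>lborel \<partial>lborel \<partial>lborel)"
    by (intro nn_integral_cong lborel_pair.Fubini') measurable
  also have "\<dots> = (\<integral>\<^sup>+y. \<integral>\<^sup>+z. autocorr k (y - z) * (g y * g z) \<partial>lborel \<partial>lborel)"
  proof (intro nn_integral_cong)
    fix y z :: real
    have "(\<integral>\<^sup>+x. (k (x - y) * g y) * (k (x - z) * g z) \<partial>lborel)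
        = (\<integral>\<^sup>+u. (k u * k (u + (y - z))) * (g y * g z) \<partial>lborel)"
      by (subst nn_integral_shift[where t = y]) (simp_all add: algebra_simps)
    then show "(\<integral>\<^sup>+x. (k (x - y) * g y) * (k (x - z) * g z) \<partial>lborel)
        = autocorr k (y - z) * (g y * g z)"
      unfolding autocorr_def by (simp add: nn_integral_multc)
  qed
  finally show ?thesis unfolding pair_energy_def .
qed

lemma ennreal_two_mult_le_sum_squares:
  fixes a b :: ennreal
  shows "2 * a * b \<le> a\<^sup>2 + b\<^sup>2"
proof (cases "a = top \<or> b = top")
  case True
  then show ?thesis by (auto simp: power2_eq_square ennreal_top_mult)
next
  case False
  then obtain x y where "a = ennreal x" "b = ennreal y" "0 \<le> x" "0 \<le> y"
    by (metis ennreal_cases)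
  moreover from calculation have "2 * a * b = ennreal (2 * x * y)" "a\<^sup>2 + b\<^sup>2 = ennreal (x\<^sup>2 + y\<^sup>2)"
    by (simp_all add: ennreal_mult ennreal_power)
  ultimately show ?thesis
    by (simp only: ennreal_leI sum_squares_bound)
qed

text \<open>The autocorrelation is largest at $0$, where it is the squared $L^2$ norm.\<close>

lemma pair_energy_le_L2:
  assumes [measurable]: "w \<in> borel_measurable borel" "g \<in> borel_measurable borel"
  shows "pair_energy w g \<le> (\<integral>\<^sup>+t. w t \<partial>lborel) * (\<integral>\<^sup>+x. (g x)\<^sup>2 \<partial>lborel)"
proof -
  define N where "N = (\<integral>\<^sup>+x. (g x)\<^sup>2 \<partial>lborel)"
  have corr: "autocorr g t \<le> N" for t
  proof -
    have "2 * autocorr g t = (\<integral>\<^sup>+x. 2 * g x * g (x + t) \<partial>lborel)"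
      unfolding autocorr_def by (simp add: nn_integral_cmult mult.assoc)
    also have "\<dots> \<le> (\<integral>\<^sup>+x. (g x)\<^sup>2 + (g (x + t))\<^sup>2 \<partial>lborel)"
      by (intro nn_integral_mono ennreal_two_mult_le_sum_squares)
    also have "\<dots> = N + (\<integral>\<^sup>+x. (g (t + x))\<^sup>2 \<partial>lborel)"
      unfolding N_def by (subst nn_integral_add) (auto simp: add.commute)
    also have "\<dots> = 2 * N"
      unfolding N_def by (subst nn_integral_shift[where t = t, symmetric]) (auto simp: mult_2)
    finally show ?thesis
      by (simp add: ennreal_mult_le_mult_iff)
  qed
  have "pair_energy w g \<le> (\<integral>\<^sup>+t. w t * N \<partial>lborel)"
    unfolding pair_energy_eq_autocorr[OF assms] by (intro nn_integral_mono mult_left_mono corr) auto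
  then show ?thesis
    unfolding N_def by (simp add: nn_integral_multc)
qed

text \<open>The mixed bound, from $2 \cdot cg \cdot (k*g) \le (cg)^2 + (k*g)^2$. The bound on the autocorrelation of $k$
and the finite $L^1$ norm serve to make the cancelled term finite.\<close>

lemma pair_energy_le_of_kernel:
  fixes b c C :: real
  assumes [measurable]: "w \<in> borel_measurable borel" "k \<in> borel_measurable borel"
    "g \<in> borel_measurable borel"
    and kernel: "\<And>t. w t + autocorr k t \<le> ennreal b + ennreal (2 * c) * k t"
    and bounded: "\<And>t. autocorr k t \<le> ennreal C"
    and L1: "(\<integral>\<^sup>+x. g x \<partial>lborel) < top" and "0 \<le> c"
  shows "pair_energy w g
      \<le> ennreal b * (\<integral>\<^sup>+x. g x \<partial>lborel)\<^sup>2 + ennreal (c\<^sup>2) * (\<integral>\<^sup>+x. (g x)\<^sup>2 \<partial>lborel)"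
    (is "_ \<le> ?B + ?A")
proof -
  let ?K = "pair_energy (autocorr k) g"
  have "?K \<le> ennreal C * (\<integral>\<^sup>+x. g x \<partial>lborel)\<^sup>2"
    using pair_energy_mono[of "autocorr k" "\<lambda>_. ennreal C" g] bounded by (simp add: pair_energy_const)
  also have "\<dots> < top"
    using L1 by (simp add: ennreal_mult_less_top power2_eq_square)
  finally have fin: "?K \<noteq> \<infinity>" by simp
  have square: "ennreal (2 * c) * pair_energy k g \<le> ?A + ?K"
  proof -
    have "ennreal (2 * c) * pair_energy k g = (\<integral>\<^sup>+x. 2 * (ennreal c * g x) * smear k g x \<partial>lborel)"
      using \<open>0 \<le> c\<close> by (simp add: pair_energy_eq_smear nn_integral_cmult[symmetric] mult_ac ennreal_mult)
    also have "\<dots> \<le> (\<integral>\<^sup>+x. (ennreal c * g x)\<^sup>2 + (smear k g x)\<^sup>2 \<partial>lborel)"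
      by (intro nn_integral_mono ennreal_two_mult_le_sum_squares)
    also have "\<dots> = ?A + ?K"
      using \<open>0 \<le> c\<close> by (simp add: nn_integral_add nn_integral_smear_sq power_mult_distrib nn_integral_cmult
          ennreal_power)
    finally show ?thesis .
  qed
  have "?K + pair_energy w g = pair_energy (\<lambda>t. w t + autocorr k t) g"
    by (simp add: pair_energy_add add.commute)
  also have "\<dots> \<le> pair_energy (\<lambda>t. ennreal b + ennreal (2 * c) * k t) g"
    by (intro pair_energy_mono kernel)
  also have "\<dots> = ?B + ennreal (2 * c) * pair_energy k g"
    by (simp add: pair_energy_add pair_energy_cmult pair_energy_const)
  also have "\<dots> \<le> ?B + (?A + ?K)"
    using square by (rule add_left_mono)
  finally have "?K + pair_energy w g \<le> ?K + (?B + ?A)"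
    by (simp add: add_ac)
  then show ?thesis
    using fin by (simp only: ennreal_add_left_cancel_le) simp
qed

section \<open>A kernel for the window of length one\<close>

text \<open>The shape is dictated by $w + A_k \le b + 2ck$. The left-hand side loses the summand
$1$ at $|t| = 1/2$, so $k$ has to keep a sizeable value up to that point and can vanish beyond it. A constant
$k = h$ on the window is too costly at $t = 0$: there $A_k(0) = h^2$, and $1 + h^2 - 2ch \ge 1 - c^2$ exceeds
$2/5$ for $c = 7/10$. A linear descent from $1$ to $3/4$ balances the two ends.\<close>

definition roof :: "real \<Rightarrow> ennreal" where
  "roof t = ennreal (1 - \<bar>t\<bar> / 2) * indicator {-1/2..1/2} t"

lemma roof_measurable [measurable]: "roof \<in> borel_measurable borel"
  unfolding roof_def by measurable

lemma autocorr_minus: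
  assumes [measurable]: "g \<in> borel_measurable borel"
  shows "autocorr g (- t) = autocorr g t"
  unfolding autocorr_def
  by (subst nn_integral_shift[where t = t]) (simp_all add: mult.commute add.commute)

lemma
  fixes f F :: "real \<Rightarrow> real"
  assumes "f \<in> borel_measurable borel" "\<And>x. x \<in> {a..b} \<Longrightarrow> (F has_real_derivative f x) (at x)"
    "\<And>x. x \<in> {a..b} \<Longrightarrow> 0 \<le> f x" "a \<le> b"
  shows nn_integral_Icc_FTC: "(\<integral>\<^sup>+x. ennreal (f x) * indicator {a..b} x \<partial>lborel) = ennreal (F b - F a)"
    and nonneg_deriv_imp_le: "F a \<le> F b"
proof -
  show "(\<integral>\<^sup>+x. ennreal (f x) * indicator {a..b} x \<partial>lborel) = ennreal (F b - F a)"
    using assms by (intro nn_integral_FTC_Icc)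
      (auto simp: has_real_derivative_iff_has_vector_derivative has_vector_derivative_at_within)
  show "F a \<le> F b"
    using assms by (intro DERIV_nonneg_imp_nondecreasing[of a b F]) auto
qed

text \<open>For $1/2 < t$ the supports of $k$ and its translate overlap on an interval of length at most
$1/2$, on which the two linear factors sum to $2 - t/2$; so their product is at most $(1-t/4)^2 \le (7/8)^2$, and
$\frac12 (7/8)^2 = 49/128 < 2/5$.\<close>

lemma autocorr_roof_far:
  assumes "1/2 < t"
  shows "autocorr roof t \<le> ennreal (2/5)"
proof -
  have pt: "roof s * roof (s + t) \<le> ennreal (49/64) * indicator {-1/2..1/2 - t} s" for s
  proof (cases "s \<in> {-1/2..1/2 - t}")
    case True
    have "(1 + s/2) * (1 - (s + t)/2) = (1 - t/4)\<^sup>2 - (s/2 + t/4)\<^sup>2"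
      by (simp add: power2_eq_square field_simps)
    also have "\<dots> \<le> (1 - t/4)\<^sup>2"
      by simp
    also have "\<dots> \<le> (7/8)\<^sup>2"
      using assms True by (intro power_mono) auto
    finally have "(1 + s/2) * (1 - (s + t)/2) \<le> 49/64" by (simp add: power2_eq_square)
    then show ?thesis
      using assms True by (auto simp: roof_def ennreal_mult[symmetric] indicator_def intro!: ennreal_leI)
  next
    case False
    then show ?thesis using assms by (auto simp: roof_def indicator_def)
  qed
  have "autocorr roof t \<le> (\<integral>\<^sup>+s. ennreal (49/64) * indicator {-1/2..1/2 - t} s \<partial>lborel)"
    unfolding autocorr_def by (intro nn_integral_mono pt)
  also have "\<dots> = ennreal (49/64) * emeasure lborel {-1/2..1/2 - t}"
    by (simp add: nn_integral_cmult_indicator)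
  also have "\<dots> \<le> ennreal (49/64) * ennreal (1/2)"
    using assms by (intro mult_left_mono) (auto simp: emeasure_lborel_Icc_eq simp del: ennreal_half intro!: ennreal_leI)
  also have "\<dots> \<le> ennreal (2/5)"
    by (simp flip: ennreal_mult add: ennreal_leI del: ennreal_half)
  finally show ?thesis .
qed

text \<open>Here the integrand $k(s)\,k(s+t)$ changes its polynomial at the peaks $s = -t$ and $s = 0$, and the
three pieces are integrated separately.\<close>

lemma autocorr_roof_near:
  assumes "0 \<le> t" "t \<le> 1/2"
  shows "autocorr roof t \<le> ennreal (37/48 - 9/16 * t - t\<^sup>2 / 2 + t^3 / 8)"
proof -
  let ?f1 = "\<lambda>s::real. (1 + s/2) * (1 + (s + t)/2)"
  let ?f2 = "\<lambda>s::real. (1 + s/2) * (1 - (s + t)/2)"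
  let ?f3 = "\<lambda>s::real. (1 - s/2) * (1 - (s + t)/2)"
  let ?F1 = "\<lambda>s::real. (1 + t/2) * s + (1 + t/4) * s\<^sup>2 / 2 + s^3 / 12"
  let ?F2 = "\<lambda>s::real. (1 - t/2) * s - t * s\<^sup>2 / 8 - s^3 / 12"
  let ?F3 = "\<lambda>s::real. (1 - t/2) * s - (1 - t/4) * s\<^sup>2 / 2 + s^3 / 12"
  have n1: "s \<in> {-1/2..-t} \<Longrightarrow> 0 \<le> ?f1 s" and n2: "s \<in> {-t..0} \<Longrightarrow> 0 \<le> ?f2 s"
    and n3: "s \<in> {0..1/2 - t} \<Longrightarrow> 0 \<le> ?f3 s" for s
    using assms by (auto intro!: mult_nonneg_nonneg simp: add_divide_distrib)
  have d1: "(?F1 has_real_derivative ?f1 s) (at s)" for s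
    by (auto intro!: derivative_eq_intros simp: field_simps power2_eq_square)
  have d2: "(?F2 has_real_derivative ?f2 s) (at s)" for s
    by (auto intro!: derivative_eq_intros simp: field_simps power2_eq_square)
  have d3: "(?F3 has_real_derivative ?f3 s) (at s)" for s
    by (auto intro!: derivative_eq_intros simp: field_simps power2_eq_square)
  have I1: "(\<integral>\<^sup>+s. ennreal (?f1 s) * indicator {-1/2..-t} s \<partial>lborel) = ennreal (?F1 (-t) - ?F1 (-1/2))"
    by (rule nn_integral_Icc_FTC[OF _ d1 n1]) (use assms in auto)
  have L1: "?F1 (-1/2) \<le> ?F1 (-t)"
    by (rule nonneg_deriv_imp_le[OF _ d1 n1]) (use assms in auto)
  have I2: "(\<integral>\<^sup>+s. ennreal (?f2 s) * indicator {-t..0} s \<partial>lborel) = ennreal (?F2 0 - ?F2 (-t))"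
    by (rule nn_integral_Icc_FTC[OF _ d2 n2]) (use assms in auto)
  have L2: "?F2 (-t) \<le> ?F2 0"
    by (rule nonneg_deriv_imp_le[OF _ d2 n2]) (use assms in auto)
  have I3: "(\<integral>\<^sup>+s. ennreal (?f3 s) * indicator {0..1/2 - t} s \<partial>lborel) = ennreal (?F3 (1/2 - t) - ?F3 0)"
    by (rule nn_integral_Icc_FTC[OF _ d3 n3]) (use assms in auto)
  have L3: "?F3 0 \<le> ?F3 (1/2 - t)"
    by (rule nonneg_deriv_imp_le[OF _ d3 n3]) (use assms in auto)
  have pt: "roof s * roof (s + t) \<le> ennreal (?f1 s) * indicator {-1/2..-t} s
      + ennreal (?f2 s) * indicator {-t..0} s + ennreal (?f3 s) * indicator {0..1/2 - t} s" for s
  proof -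
    consider "s \<notin> {-1/2..1/2 - t}" | "s \<in> {-1/2..<-t}" | "s \<in> {-t..<0}" | "s \<in> {0..1/2 - t}"
      using assms by force
    then show ?thesis
      using assms by cases
        (auto simp: roof_def ennreal_mult[symmetric] indicator_def add_divide_distrib diff_divide_distrib)
  qed
  have "autocorr roof t \<le> (\<integral>\<^sup>+s. ennreal (?f1 s) * indicator {-1/2..-t} s
      + ennreal (?f2 s) * indicator {-t..0} s + ennreal (?f3 s) * indicator {0..1/2 - t} s \<partial>lborel)"
    unfolding autocorr_def by (intro nn_integral_mono pt)
  also have "\<dots> = ennreal (?F1 (-t) - ?F1 (-1/2)) + ennreal (?F2 0 - ?F2 (-t))
      + ennreal (?F3 (1/2 - t) - ?F3 0)"
    by (simp add: nn_integral_add I1[simplified] I2[simplified] I3[simplified])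
  also have "\<dots> = ennreal ((?F1 (-t) - ?F1 (-1/2)) + (?F2 0 - ?F2 (-t)) + (?F3 (1/2 - t) - ?F3 0))"
    using L1 L2 L3 by (simp only: ennreal_plus[symmetric] diff_ge_0_iff_ge add_nonneg_nonneg)
  also have "(?F1 (-t) - ?F1 (-1/2)) + (?F2 0 - ?F2 (-t)) + (?F3 (1/2 - t) - ?F3 0)
      = 37/48 - 9/16 * t - t\<^sup>2 / 2 + t^3 / 8"
    by (simp add: power2_eq_square power3_eq_cube field_simps)
  finally show ?thesis .
qed

text \<open>On the window the claim is a cubic inequality in $|t|$. Estimating $|t|^3 \le |t|^2/2$ reduces it to a quadratic
one that holds with room to spare; outside the window the kernel vanishes and only $A_k \le 2/5$ is left.\<close>

lemma roof_kernel_bound: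
  "indicator {-1/2..1/2} t + autocorr roof t \<le> ennreal (2/5) + ennreal (2 * (7/10)) * roof t"
proof (cases "\<bar>t\<bar> \<le> 1/2")
  case True
  define u where "u = \<bar>t\<bar>"
  have u: "0 \<le> u" "u \<le> 1/2" using True by (auto simp: u_def)
  have "autocorr roof t = autocorr roof u"
    by (auto simp: u_def abs_if autocorr_minus)
  also have "\<dots> \<le> ennreal (37/48 - 9/16 * u - u\<^sup>2 / 2 + u^3 / 8)"
    using u by (rule autocorr_roof_near)
  also have "\<dots> \<le> ennreal (4/5 - 7/10 * u)"
  proof (rule ennreal_leI)
    have "u^3 \<le> u\<^sup>2 / 2"
      using u mult_right_mono[of u "1/2" "u\<^sup>2"] by (simp add: power2_eq_square power3_eq_cube)
    \<comment> \<open>the maximum of $\frac{11}{80} u - \frac{7}{16} u^2$ is at $u = 11/70$\<close>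
    moreover have "0 \<le> (u - 11/70)\<^sup>2" by simp
    ultimately show "37/48 - 9/16 * u - u\<^sup>2 / 2 + u^3 / 8 \<le> 4/5 - 7/10 * u"
      by (simp add: power2_eq_square field_simps)
  qed
  finally have "indicator {-1/2..1/2} t + autocorr roof t \<le> ennreal 1 + ennreal (4/5 - 7/10 * u)"
    using True by (intro add_mono) (auto simp: indicator_def)
  also have "\<dots> = ennreal (2/5) + ennreal (2 * (7/10)) * roof t"
  proof -
    have "roof t = ennreal (1 - u/2)"
      using True by (auto simp: roof_def u_def indicator_def abs_le_iff)
    moreover have "1 + (4/5 - 7/10 * u) = 2/5 + 2 * (7/10) * (1 - u/2)"
      by (simp add: field_simps)
    ultimately show ?thesis
      using u by (simp only: ennreal_mult[symmetric] ennreal_plus[symmetric])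
  qed
  finally show ?thesis .
next
  case False
  then have "t \<notin> {-1/2..1/2}" by auto
  moreover have "autocorr roof t = autocorr roof \<bar>t\<bar>"
    by (auto simp: abs_if autocorr_minus)
  ultimately show ?thesis
    using autocorr_roof_far[of "\<bar>t\<bar>"] False by (simp add: roof_def)
qed

lemma pair_energy_window_le:
  assumes [measurable]: "g \<in> borel_measurable borel"
    and L1: "(\<integral>\<^sup>+x. g x \<partial>lborel) < top"
  shows "pair_energy (indicator {-1/2..1/2}) g
    \<le> ennreal (2/5) * (\<integral>\<^sup>+x. g x \<partial>lborel)\<^sup>2 + ennreal ((7/10)\<^sup>2) * (\<integral>\<^sup>+x. (g x)\<^sup>2 \<partial>lborel)"
proof (rule pair_energy_le_of_kernel[OF _ _ _ roof_kernel_bound _ L1])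
  fix t
  have "roof t \<le> ennreal 1"
    by (auto simp: roof_def indicator_def intro!: ennreal_leI simp del: ennreal_1)
  have "autocorr roof t \<le> indicator {-1/2..1/2} t + autocorr roof t"
    by (rule add_increasing) auto
  also note roof_kernel_bound
  also have "ennreal (2/5) + ennreal (2 * (7/10)) * roof t \<le> ennreal (2/5) + ennreal (2 * (7/10)) * ennreal 1"
    using \<open>roof t \<le> ennreal 1\<close> by (intro add_left_mono mult_left_mono) auto
  also have "\<dots> = ennreal (9/5)"
    by (simp flip: ennreal_plus)
  finally show "autocorr roof t \<le> ennreal (9/5)" .
qed auto

section \<open>The upper bound\<close>

text \<open>A function that is not integrable has Bochner integral $0$. This lets the inner and the outer integral of
the main inequality be bounded at once, before any question of convergence.\<close>

lemma ennreal_abs_integral_le_nn_integral: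
  fixes f :: "'a \<Rightarrow> real"
  shows "ennreal \<bar>\<integral>x. f x \<partial>M\<bar> \<le> (\<integral>\<^sup>+x. ennreal \<bar>f x\<bar> \<partial>M)"
proof (cases "integrable M f")
  case True
  then show ?thesis
    using integral_norm_bound_ennreal by fastforce
qed (simp add: not_integrable_integral_eq)

lemma AE_lborel_shift:
  fixes P :: "real \<Rightarrow> bool"
  assumes "AE x in lborel. P x"
  shows "AE x in lborel. P (x + t)"
proof -
  obtain N where N: "N \<in> null_sets lborel" "{x \<in> space lborel. \<not> P x} \<subseteq> N"
    using assms by (rule eventually_ae_filter[THEN iffD1, THEN bexE])
  have "AE x in lborel. t + 1 * x \<notin> N"
    using N(1) by (intro AE_borel_affine AE_not_in) auto
  then show ?thesis
    by eventually_elim (use N(2) in \<open>auto simp: add.commute\<close>)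
qed

text \<open>The mixed bound gives the claim where $(7p-5q)(8q-7p) \ge 0$. Otherwise $p/q < 5/7$ or $q/p < 7/8$, and since
$5/7$ and $7/8$ are below $0.91$ a trivial bound suffices.\<close>

lemma le_of_quadratic_bounds:
  fixes S p q :: real
  assumes "0 \<le> p" "0 \<le> q" "S \<le> p\<^sup>2" "S \<le> q\<^sup>2" "S \<le> 2/5 * q\<^sup>2 + (7/10)\<^sup>2 * p\<^sup>2"
  shows "S \<le> 0.91 * q * p"
proof -
  consider "7 * p < 5 * q" | "8 * q < 7 * p" | "5 * q \<le> 7 * p" "7 * p \<le> 8 * q" by linarith
  then show ?thesis
  proof cases
    case 1
    then have "p * p \<le> 0.91 * q * p" using assms by (intro mult_right_mono) auto
    then show ?thesis using assms(3) by (simp add: power2_eq_square)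
  next
    case 2
    then have "q * q \<le> q * (0.91 * p)" using assms by (intro mult_left_mono) auto
    then show ?thesis using assms(4) by (simp add: power2_eq_square mult_ac)
  next
    case 3
    then have "0 \<le> (7 * p - 5 * q) * (8 * q - 7 * p)" by simp
    then show ?thesis using assms(5) by (simp add: power2_eq_square algebra_simps)
  qed
qed

text \<open>The quadratic forms need a Borel function, so $|f|$ is first replaced by a Borel representative; translations
preserve null sets, hence the autocorrelation is unaffected at every shift.\<close>

lemma window_correlation_le:
  assumes "L1_fun f" "L2_fun f"
  shows "(LINT t:{-1/2..1/2}|lebesgue. (LINT x|lebesgue. f x * f (x + t)))
    \<le> 0.91 * L1_norm f * L2_norm f" (is "?S \<le> _")
proof -
  let ?I = "{-1/2..1/2::real}"
  have [measurable]: "f \<in> borel_measurable lebesgue"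
    using assms(1) by (simp add: L1_fun_def)
  have "(\<lambda>x. ennreal \<bar>f x\<bar>) \<in> borel_measurable lebesgue"
    by measurable
  from completion_ex_borel_measurable[OF this]
  obtain g where g [measurable]: "g \<in> borel_measurable borel"
    and fg: "AE x in lborel. ennreal \<bar>f x\<bar> = g x"
    by auto
  have g1: "(\<integral>\<^sup>+x. g x \<partial>lborel) = ennreal (L1_norm f)"
  proof -
    have "(\<integral>\<^sup>+x. g x \<partial>lborel) = (\<integral>\<^sup>+x. ennreal \<bar>f x\<bar> \<partial>lebesgue)"
      unfolding nn_integral_completion using fg by (intro nn_integral_cong_AE) auto
    also have "\<dots> = ennreal (L1_norm f)"
      using assms(1) unfolding L1_fun_def L1_norm_def by (intro nn_integral_eq_integral) auto
    finally show ?thesis .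
  qed
  have g2: "(\<integral>\<^sup>+x. (g x)\<^sup>2 \<partial>lborel) = ennreal ((L2_norm f)\<^sup>2)"
  proof -
    have "(\<integral>\<^sup>+x. (g x)\<^sup>2 \<partial>lborel) = (\<integral>\<^sup>+x. ennreal (\<bar>f x\<bar>\<^sup>2) \<partial>lebesgue)"
      unfolding nn_integral_completion using fg
      by (intro nn_integral_cong_AE, eventually_elim) (metis abs_ge_zero ennreal_power)
    also have "\<dots> = ennreal ((L2_norm f)\<^sup>2)"
      using assms(2) unfolding L2_fun_def L2_norm_def
      by (subst nn_integral_eq_integral) auto
    finally show ?thesis .
  qed
  have corr: "ennreal \<bar>LINT x|lebesgue. f x * f (x + t)\<bar> \<le> autocorr g t" for t
  proof -
    have "ennreal \<bar>LINT x|lebesgue. f x * f (x + t)\<bar> \<le> (\<integral>\<^sup>+x. ennreal \<bar>f x * f (x + t)\<bar> \<partial>lebesgue)"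
      by (rule ennreal_abs_integral_le_nn_integral)
    also have "\<dots> = autocorr g t"
      unfolding nn_integral_completion autocorr_def
      using fg AE_lborel_shift[OF fg, of t]
      by (intro nn_integral_cong_AE, eventually_elim) (simp add: abs_mult ennreal_mult)
    finally show ?thesis .
  qed
  have "ennreal ?S \<le> ennreal \<bar>?S\<bar>"
    by (rule ennreal_leI) simp
  also have "\<dots> \<le> (\<integral>\<^sup>+t. ennreal \<bar>indicator ?I t * (LINT x|lebesgue. f x * f (x + t))\<bar> \<partial>lebesgue)"
    unfolding set_lebesgue_integral_def real_scaleR_def by (rule ennreal_abs_integral_le_nn_integral)
  also have "\<dots> \<le> (\<integral>\<^sup>+t. indicator ?I t * autocorr g t \<partial>lborel)"
    unfolding nn_integral_completion
    by (intro nn_integral_mono) (auto simp: indicator_def corr)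
  also have "\<dots> = pair_energy (indicator ?I) g"
    by (simp add: pair_energy_eq_autocorr)
  finally have S: "ennreal ?S \<le> pair_energy (indicator ?I) g" .
  have nonneg: "0 \<le> L1_norm f" "0 \<le> L2_norm f"
    by (auto simp: L1_norm_def L2_norm_def)
  have S2: "?S \<le> (L2_norm f)\<^sup>2"
  proof -
    have "ennreal ?S \<le> ennreal ((L2_norm f)\<^sup>2)"
      using order_trans[OF S pair_energy_le_L2] by (simp add: g2)
    then show ?thesis by (simp add: ennreal_le_iff)
  qed
  have S1: "?S \<le> (L1_norm f)\<^sup>2"
  proof -
    have "pair_energy (indicator ?I) g \<le> pair_energy (\<lambda>_. 1) g"
      by (intro pair_energy_mono) (auto simp: indicator_def)
    also have "\<dots> = ennreal ((L1_norm f)\<^sup>2)"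
      by (simp add: pair_energy_const g1 ennreal_power nonneg)
    finally have "ennreal ?S \<le> ennreal ((L1_norm f)\<^sup>2)"
      using S by (rule order_trans[rotated])
    then show ?thesis by (simp add: ennreal_le_iff)
  qed
  have S3: "?S \<le> 2/5 * (L1_norm f)\<^sup>2 + (7/10)\<^sup>2 * (L2_norm f)\<^sup>2"
  proof -
    have fin: "(\<integral>\<^sup>+x. g x \<partial>lborel) < top"
      by (simp add: g1)
    note order_trans[OF S pair_energy_window_le[OF g fin]]
    also have "ennreal (2/5) * (\<integral>\<^sup>+x. g x \<partial>lborel)\<^sup>2 + ennreal ((7/10)\<^sup>2) * (\<integral>\<^sup>+x. (g x)\<^sup>2 \<partial>lborel)
        = ennreal (2/5 * (L1_norm f)\<^sup>2) + ennreal ((7/10)\<^sup>2 * (L2_norm f)\<^sup>2)"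
      unfolding g1 g2 ennreal_power[OF nonneg(1)] by (intro arg_cong2[where f = "(+)"] ennreal_mult[symmetric]) auto
    also have "\<dots> = ennreal (2/5 * (L1_norm f)\<^sup>2 + (7/10)\<^sup>2 * (L2_norm f)\<^sup>2)"
      by (intro ennreal_plus[symmetric]) auto
    finally show ?thesis
      by (subst (asm) ennreal_le_iff) auto
  qed
  show ?thesis
    using le_of_quadratic_bounds[OF nonneg(2,1) S2 S1 S3] .
qed

section \<open>The lower bound\<close>

lemma
  fixes f F :: "real \<Rightarrow> real"
  assumes "a \<le> b" and deriv: "\<And>x. x \<in> {a..b} \<Longrightarrow> (F has_real_derivative f x) (at x within {a..b})"
    and cont: "continuous_on {a..b} f"
  shows set_integrable_lebesgue_Icc: "set_integrable lebesgue {a..b} f"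
    and set_integral_lebesgue_FTC: "(LINT x:{a..b}|lebesgue. f x) = F b - F a"
proof -
  show *: "set_integrable lebesgue {a..b} f"
    using cont by (rule absolutely_integrable_continuous_real)
  have "(f has_integral F b - F a) {a..b}"
    using assms by (intro fundamental_theorem_of_calculus)
      (auto simp: has_real_derivative_iff_has_vector_derivative)
  then show "(LINT x:{a..b}|lebesgue. f x) = F b - F a"
    using set_lebesgue_integral_eq_integral(2)[OF *] by (simp add: integral_unique)
qed

definition parabola :: "real \<Rightarrow> real" where
  "parabola x = x * (1 - x) * indicator {0..1} x"

lemma parabola_measurable [measurable]: "parabola \<in> borel_measurable lebesgue"
proof -
  have "parabola \<in> borel_measurable lborel"
    unfolding parabola_def by measurable
  then show ?thesis by (rule measurable_completion)
qed

lemma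
  shows L1_fun_parabola: "L1_fun parabola" and L1_norm_parabola: "L1_norm parabola = 1/6"
proof -
  have eq: "\<bar>parabola x\<bar> = indicator {0..1} x *\<^sub>R (x * (1 - x))" for x
    by (auto simp: parabola_def indicator_def)
  have d: "((\<lambda>x. x^2/2 - x^3/3) has_real_derivative x * (1 - x)) (at x within {0..1})" for x :: real
    by (auto intro!: derivative_eq_intros simp: power2_eq_square algebra_simps)
  have c: "continuous_on {0..1} (\<lambda>x::real. x * (1 - x))"
    by (intro continuous_intros)
  show "L1_fun parabola"
    using set_integrable_lebesgue_Icc[OF _ d c] unfolding L1_fun_def eq set_integrable_def
    by (simp add: parabola_measurable)
  show "L1_norm parabola = 1/6"
    using set_integral_lebesgue_FTC[OF _ d c] unfolding L1_norm_def eq set_lebesgue_integral_def by simp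
qed

lemma
  shows L2_fun_parabola: "L2_fun parabola" and L2_norm_parabola: "L2_norm parabola = sqrt (1/30)"
proof -
  have eq: "\<bar>parabola x\<bar> ^ 2 = indicator {0..1} x *\<^sub>R (x * (1 - x)) ^ 2" for x
    by (auto simp: parabola_def indicator_def)
  have d: "((\<lambda>x. x^3/3 - x^4/2 + x^5/5) has_real_derivative (x * (1 - x)) ^ 2) (at x within {0..1})" for x :: real
    by (auto intro!: derivative_eq_intros simp: power2_eq_square power3_eq_cube power4_eq_xxxx algebra_simps)
  have c: "continuous_on {0..1} (\<lambda>x::real. (x * (1 - x)) ^ 2)"
    by (intro continuous_intros)
  show "L2_fun parabola"
    using set_integrable_lebesgue_Icc[OF _ d c] unfolding L2_fun_def eq set_integrable_def
    by (simp add: parabola_measurable)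
  show "L2_norm parabola = sqrt (1/30)"
    using set_integral_lebesgue_FTC[OF _ d c] unfolding L2_norm_def eq set_lebesgue_integral_def by simp
qed

text \<open>The product is supported on $[\max(0,-t), \min(1,1-t)]$, where it is the same
polynomial for either sign of $t$, so that one antiderivative serves both. The value depends only on $|t|$
because every autocorrelation is even.\<close>

lemma parabola_correlation:
  assumes "\<bar>t\<bar> \<le> 1"
  shows "(LINT x|lebesgue. parabola x * parabola (x + t)) = (1 - 5 * \<bar>t\<bar>^2 + 5 * \<bar>t\<bar>^3 - \<bar>t\<bar>^5) / 30"
proof -
  let ?f = "\<lambda>x::real. x * (1 - x) * ((x + t) * (1 - (x + t)))"
  let ?F = "\<lambda>x::real. (t - t^2) * x^2/2 + (1 - 3*t + t^2) * x^3/3 + (t - 1) * x^4/2 + x^5/5"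
  let ?a = "max 0 (- t)" and ?b = "min 1 (1 - t)"
  have d: "(?F has_real_derivative ?f x) (at x within {?a..?b})" for x
  proof -
    have "?f x = (t - t^2) * x + (1 - 3*t + t^2) * x^2 + 2 * (t - 1) * x^3 + x^4"
      by (simp add: power2_eq_square power3_eq_cube power4_eq_xxxx algebra_simps)
    then show ?thesis
      by (auto intro!: derivative_eq_intros)
  qed
  have c: "continuous_on {?a..?b} ?f"
    by (intro continuous_intros)
  have "(LINT x|lebesgue. parabola x * parabola (x + t)) = (LINT x:{?a..?b}|lebesgue. ?f x)"
    unfolding set_lebesgue_integral_def
    by (intro Bochner_Integration.integral_cong) (auto simp: parabola_def indicator_def)
  also have "\<dots> = ?F ?b - ?F ?a"
    using assms by (intro set_integral_lebesgue_FTC[OF _ d c]) auto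
  also have "\<dots> = (1 - 5 * \<bar>t\<bar>^2 + 5 * \<bar>t\<bar>^3 - \<bar>t\<bar>^5) / 30"
  proof (cases "0 \<le> t")
    case True
    then have "?a = 0" "?b = 1 - t" "\<bar>t\<bar> = t" by auto
    then show ?thesis
      by (simp only:) (simp add: field_simps eval_nat_numeral)
  next
    case False
    then have "?a = -t" "?b = 1" "\<bar>t\<bar> = -t" by auto
    then show ?thesis
      by (simp only:) (simp add: field_simps eval_nat_numeral)
  qed
  finally show ?thesis .
qed

text \<open>The autocorrelation is a polynomial in $|t|$, so it is integrated separately on the two halves of the window,
with $c = \pm 1$ in the antiderivative supplying the sign of $t$ in its odd powers.\<close>

lemma parabola_window_correlation:
  "(LINT t:{-1/2..1/2}|lebesgue. (LINT x|lebesgue. parabola x * parabola (x + t))) = 47/1920"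
proof -
  let ?h = "\<lambda>t::real. (1 - 5 * \<bar>t\<bar>^2 + 5 * \<bar>t\<bar>^3 - \<bar>t\<bar>^5) / 30"
  let ?H = "\<lambda>c t::real. (t - 5 * t^3/3 + c * (5 * t^4/4 - t^6/6)) / 30"
  have "(LINT t:{-1/2..1/2}|lebesgue. (LINT x|lebesgue. parabola x * parabola (x + t)))
      = (LINT t:{-1/2..1/2}|lebesgue. ?h t)"
    by (intro set_lebesgue_integral_cong) (auto simp: parabola_correlation)
  also have "\<dots> = integral {-1/2..1/2} ?h"
    by (intro set_lebesgue_integral_eq_integral absolutely_integrable_continuous_real continuous_intros)
      auto
  also have "\<dots> = 47/1920"
  proof (rule integral_unique)
    have "(?h has_integral ?H (-1) 0 - ?H (-1) (-1/2)) {-1/2..0}"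
      by (intro fundamental_theorem_of_calculus)
        (auto simp: has_real_derivative_iff_has_vector_derivative[symmetric] field_simps eval_nat_numeral
          intro!: derivative_eq_intros)
    moreover have "(?h has_integral ?H 1 (1/2) - ?H 1 0) {0..1/2}"
      by (intro fundamental_theorem_of_calculus)
        (auto simp: has_real_derivative_iff_has_vector_derivative[symmetric] field_simps eval_nat_numeral
          intro!: derivative_eq_intros)
    ultimately have "(?h has_integral (?H (-1) 0 - ?H (-1) (-1/2)) + (?H 1 (1/2) - ?H 1 0)) {-1/2..1/2}"
      by (intro has_integral_combine) auto
    then show "(?h has_integral 47/1920) {-1/2..1/2}"
      by (simp add: field_simps eval_nat_numeral)
  qed
  finally show ?thesis .
qed

lemma parabola_window_correlation_gt:
  "0.8 * L1_norm parabola * L2_norm parabola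
    < (LINT t:{-1/2..1/2}|lebesgue. (LINT x|lebesgue. parabola x * parabola (x + t)))"
proof -
  have "sqrt (1/30) < 47/256"
    by (rule real_less_lsqrt) (auto simp: power2_eq_square)
  then show ?thesis
    unfolding L1_norm_parabola L2_norm_parabola parabola_window_correlation by simp
qed

theorem theorem1:
  "(\<forall>f :: real \<Rightarrow> real. L1_fun f \<and> L2_fun f \<longrightarrow>
      (LINT t:{-1/2..1/2}|lebesgue. (LINT x|lebesgue. f x * f (x + t)))
        \<le> 0.91 * L1_norm f * L2_norm f) \<and>
   (\<exists>f :: real \<Rightarrow> real. L1_fun f \<and> L2_fun f \<and>
      (LINT t:{-1/2..1/2}|lebesgue. (LINT x|lebesgue. f x * f (x + t)))
        > 0.8 * L1_norm f * L2_norm f)"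
  using window_correlation_le L1_fun_parabola L2_fun_parabola parabola_window_correlation_gt by blast

end
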